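(* Let $A \in \mathbb{R}^{n\times n}$ be any matrix with at most $\deg_{\max}(A)$ non-zero entries in each row and each column, and with at least $\deg_{\min}(A)$ non-zero entries in each row and each column. Then $$\deg_{\min}(A) \leq \mu(A) \leq \deg_{\max}(A).$$
   Context: $\|\cdot\|$ denotes the spectral norm (largest singular value) and $\|\cdot\|_\infty$ denotes the largest absolute value of an entry. For $M\in\mathbb{R}^{n\times n}$, $\mathrm{support}(M)$ is the set of index pairs $(i,j)$ with $M_{i,j}\neq 0$, and $$\Omega(M) = \{N \in \mathbb{R}^{n\times n} : \mathrm{support}(N) \subseteq \mathrm{support}(M)\}, \qquad \mu(M) = \max_{N \in \Omega(M),\ \|N\|_\infty \leq 1} \|N\|.$$ *)

theory Defs
  imports "HOL-Analysis.Analysis"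
begin

definition singular_values :: "real^'n^'n \<Rightarrow> real set" where
  "singular_values M =
     {sqrt l | l. \<exists>v. v \<noteq> 0 \<and> (transpose M ** M) *v v = l *\<^sub>R v}"

definition spectral_norm :: "real^'n^'n \<Rightarrow> real" where
  "spectral_norm M = (GREATEST s. s \<in> singular_values M)"

definition entry_norm :: "real^'n^'n \<Rightarrow> real" where
  "entry_norm M = Max (range (\<lambda>(i, j). \<bar>M $ i $ j\<bar>))"

definition mat_support :: "real^'n^'n \<Rightarrow> ('n \<times> 'n) set" where
  "mat_support M = {(i, j). M $ i $ j \<noteq> 0}"

definition Omega :: "real^'n^'n \<Rightarrow> (real^'n^'n) set" where
  "Omega M = {N. mat_support N \<subseteq> mat_support M}"

definition mu :: "real^'n^'n \<Rightarrow> real" where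
  "mu M = (GREATEST r. \<exists>N \<in> Omega M. entry_norm N \<le> 1 \<and> r = spectral_norm N)"

text \<open>\<^const>\<open>Greatest\<close> is unspecified when there is no greatest element; the lemmas
  \<open>spectral_norm_singular_value\<close> and \<open>mu_attained\<close> show that both maxima exist.\<close>

lemma spectral_norm_singular_value:
  fixes M :: "real^'n^'n"
  shows "spectral_norm M \<in> singular_values M"
    and "s \<in> singular_values M \<Longrightarrow> s \<le> spectral_norm M"
    and "spectral_norm M = onorm ((*v) M)"
proof -
  let ?f = "(*v) M"
  have bl: "bounded_linear ?f" by (simp add: matrix_vector_mul_bounded_linear)
  have bnd: "norm (M *v w) \<le> onorm ?f * norm w" for w using onorm[OF bl] .
  have adj: "(transpose M *v y) \<bullet> x = y \<bullet> (M *v x)" for x y :: "real^'n"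
    by (simp add: dot_lmul_matrix)
  have sq: "((transpose M ** M) *v v) \<bullet> w = (M *v v) \<bullet> (M *v w)" for v w
    by (metis adj matrix_vector_mul_assoc)
  have upper: "s \<le> onorm ?f" if "s \<in> singular_values M" for s
  proof -
    from that obtain l v where s: "s = sqrt l" and v: "v \<noteq> 0"
      and ev: "(transpose M ** M) *v v = l *\<^sub>R v"
      unfolding singular_values_def by blast
    have "(norm (M *v v))\<^sup>2 = l * (norm v)\<^sup>2"
      using sq[of v v] ev by (simp add: power2_norm_eq_inner)
    then have "sqrt ((norm (M *v v))\<^sup>2) = sqrt l * sqrt ((norm v)\<^sup>2)"
      by (simp only: real_sqrt_mult)
    then have "s * norm v = norm (M *v v)"
      by (simp add: s)
    then have "s * norm v \<le> onorm ?f * norm v" using bnd[of v] by simp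
    then show ?thesis using v by simp
  qed
  have mem: "onorm ?f \<in> singular_values M"
  proof -
    define b :: "real^'n" where "b = (SOME i. i \<in> Basis)"
    have "b \<in> sphere 0 1" unfolding b_def by (simp add: SOME_Basis)
    then have "sphere (0::real^'n) 1 \<noteq> {}" by blast
    moreover have "continuous_on (sphere 0 1) (\<lambda>w. norm (M *v w))"
      by (intro continuous_on_norm linear_continuous_on bl)
    ultimately obtain v where v: "v \<in> sphere 0 1"
      and mx: "\<And>w. w \<in> sphere 0 1 \<Longrightarrow> norm (M *v w) \<le> norm (M *v v)"
      using continuous_attains_sup[OF compact_sphere, of 0 1 "\<lambda>w. norm (M *v w)"]
      by blast
    define c where "c = norm (M *v v)"
    have vn: "norm v = 1" using v by simp
    have c0: "c \<ge> 0" by (simp add: c_def)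
    have le: "norm (M *v w) \<le> c * norm w" for w
    proof (cases "w = 0")
      case False
      have "norm (M *v ((1 / norm w) *\<^sub>R w)) \<le> c"
        unfolding c_def using False by (intro mx) simp
      then have "norm (M *v w) / norm w \<le> c"
        by (simp add: matrix_vector_mult_scaleR)
      then show ?thesis using False by (simp add: divide_simps)
    qed simp
    have oc: "onorm ?f = c"
    proof (rule antisym)
      show "onorm ?f \<le> c" by (rule onorm_le) (rule le)
      show "c \<le> onorm ?f" using bnd[of v] vn by (simp add: c_def)
    qed
    define z where "z = (transpose M ** M) *v v"
    have zz: "z \<bullet> z \<le> c^2 * norm z"
    proof -
      have "z \<bullet> z = (M *v v) \<bullet> (M *v z)" unfolding z_def by (rule sq)
      also have "\<dots> \<le> norm (M *v v) * norm (M *v z)" by (rule norm_cauchy_schwarz)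
      also have "\<dots> \<le> c * (c * norm z)"
        using le[of z] c0 by (simp add: c_def mult_left_mono)
      finally show ?thesis by (simp add: power2_eq_square)
    qed
    have zn: "norm z \<le> c^2"
    proof (cases "z = 0")
      case False
      then have "norm z * norm z \<le> c^2 * norm z"
        using zz by (simp add: power2_norm_eq_inner flip: power2_eq_square)
      then show ?thesis using False by simp
    qed simp
    have zv: "z \<bullet> v = c^2"
      unfolding z_def c_def by (simp add: sq power2_norm_eq_inner)
    have "(norm (z - c^2 *\<^sub>R v))\<^sup>2 = (norm z)\<^sup>2 - 2 * c^2 * (z \<bullet> v) + c^2 * c^2 * (norm v)\<^sup>2"
      by (simp only: power2_norm_eq_inner) (simp add: algebra_simps inner_commute)
    also have "\<dots> = (norm z)\<^sup>2 - (c^2)^2"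
      using zv vn by (simp add: power2_eq_square)
    also have "\<dots> \<le> 0" using power_mono[OF zn, of 2] by simp
    finally have "(transpose M ** M) *v v = c^2 *\<^sub>R v" by (simp add: z_def)
    moreover have "v \<noteq> 0" using vn by auto
    ultimately have "sqrt (c^2) \<in> singular_values M"
      unfolding singular_values_def by blast
    then show ?thesis using c0 oc by simp
  qed
  show eq: "spectral_norm M = onorm ?f"
    unfolding spectral_norm_def using mem upper by (rule Greatest_equality)
  show "spectral_norm M \<in> singular_values M" using mem eq by simp
  show "s \<le> spectral_norm M" if "s \<in> singular_values M" using upper[OF that] eq by simp
qed

lemma entry_norm_le_iff: "entry_norm M \<le> c \<longleftrightarrow> (\<forall>i j. \<bar>M $ i $ j\<bar> \<le> c)"
  unfolding entry_norm_def by (subst Max_le_iff) auto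

lemma mu_attained:
  fixes M :: "real^'n^'n"
  shows "\<exists>N \<in> Omega M. entry_norm N \<le> 1 \<and> mu M = spectral_norm N"
    and "N \<in> Omega M \<Longrightarrow> entry_norm N \<le> 1 \<Longrightarrow> spectral_norm N \<le> mu M"
proof -
  let ?K = "{N \<in> Omega M. entry_norm N \<le> 1}"
  have K: "?K = (\<Inter>i j. {N. (M $ i $ j = 0 \<longrightarrow> N $ i $ j = 0) \<and> \<bar>N $ i $ j\<bar> \<le> 1})"
    by (auto simp: Omega_def mat_support_def entry_norm_le_iff)
  have cl: "closed {N::real^'n^'n. (M $ i $ j = 0 \<longrightarrow> N $ i $ j = 0) \<and> \<bar>N $ i $ j\<bar> \<le> 1}" for i j
  proof -
    have "closed {N::real^'n^'n. N $ i $ j = 0}" "closed {N::real^'n^'n. \<bar>N $ i $ j\<bar> \<le> 1}"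
      by (rule closed_Collect_eq closed_Collect_le; intro continuous_intros)+
    then show ?thesis by (cases "M $ i $ j = 0") (simp_all add: closed_Collect_conj)
  qed
  have closed: "closed ?K" unfolding K using cl by auto
  have "norm N \<le> (\<Sum>i\<in>(UNIV::'n set). \<Sum>j\<in>(UNIV::'n set). 1)" if "N \<in> ?K" for N
  proof -
    have "norm N \<le> (\<Sum>i\<in>UNIV. norm (N $ i))" by (simp add: norm_le_l1_cart norm_vec_def L2_set_le_sum)
    also have "\<dots> \<le> (\<Sum>i\<in>UNIV. \<Sum>j\<in>UNIV. \<bar>N $ i $ j\<bar>)"
      by (intro sum_mono norm_le_l1_cart)
    also have "\<dots> \<le> (\<Sum>i\<in>(UNIV::'n set). \<Sum>j\<in>(UNIV::'n set). 1)"
      using that by (intro sum_mono) (auto simp: entry_norm_le_iff)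
    finally show ?thesis .
  qed
  then have "bounded ?K" by (rule boundedI)
  with closed have compact: "compact ?K" by (simp add: compact_eq_bounded_closed)
  have "0 \<in> ?K" by (auto simp: Omega_def mat_support_def entry_norm_le_iff)
  then have ne: "?K \<noteq> {}" by blast
  have bl: "bounded_linear ((*v) (N::real^'n^'n))" for N
    by (simp add: matrix_vector_mul_bounded_linear)
  have tri: "onorm ((*v) A) \<le> onorm ((*v) B) + onorm ((*v) (A - B))" for A B :: "real^'n^'n"
    using onorm_triangle[OF bl bl, of B "A - B"]
    by (simp flip: matrix_vector_mult_add_rdistrib)
  have small: "onorm ((*v) A) \<le> (\<Sum>i\<in>UNIV. \<Sum>j\<in>UNIV. \<bar>A $ i $ j\<bar>)" for A :: "real^'n^'n"
    using onorm_le_matrix_component_sum .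
  have cont: "continuous_on ?K (\<lambda>N. onorm ((*v) N))"
    unfolding continuous_on_def
  proof
    fix A :: "real^'n^'n"
    have "((\<lambda>N. \<Sum>i\<in>UNIV. \<Sum>j\<in>UNIV. \<bar>(N - A) $ i $ j\<bar>) \<longlongrightarrow>
             (\<Sum>i\<in>UNIV. \<Sum>j\<in>UNIV. \<bar>(A - A) $ i $ j\<bar>)) (at A within ?K)"
      by (intro tendsto_intros)
    then have lim: "((\<lambda>N. \<Sum>i\<in>UNIV. \<Sum>j\<in>UNIV. \<bar>(N - A) $ i $ j\<bar>) \<longlongrightarrow> 0) (at A within ?K)"
      by simp
    have "norm (onorm ((*v) N) - onorm ((*v) A)) \<le> (\<Sum>i\<in>UNIV. \<Sum>j\<in>UNIV. \<bar>(N - A) $ i $ j\<bar>)"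
      for N
      using tri[of N A] tri[of A N] small[of "N - A"] small[of "A - N"]
      by (simp add: abs_le_iff abs_minus_commute)
    then have "((\<lambda>N. onorm ((*v) N) - onorm ((*v) A)) \<longlongrightarrow> 0) (at A within ?K)"
      by (intro Lim_null_comparison[OF _ lim]) simp
    then show "((\<lambda>N. onorm ((*v) N)) \<longlongrightarrow> onorm ((*v) A)) (at A within ?K)"
      by (rule LIM_zero_cancel)
  qed
  obtain N0 where N0: "N0 \<in> ?K" and mx: "\<And>N. N \<in> ?K \<Longrightarrow> spectral_norm N \<le> spectral_norm N0"
    using continuous_attains_sup[OF compact ne cont]
    by (auto simp: spectral_norm_singular_value(3))
  have eq: "mu M = spectral_norm N0"
    unfolding mu_def by (rule Greatest_equality) (use N0 mx in auto)
  show "\<exists>N \<in> Omega M. entry_norm N \<le> 1 \<and> mu M = spectral_norm N" using N0 eq by auto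
  show "spectral_norm N \<le> mu M" if "N \<in> Omega M" "entry_norm N \<le> 1"
    using mx that eq by auto
qed

end

(* Upper bound: Schur's test, since the rows and columns of an admissible matrix have absolute
   sums at most deg_max. Lower bound: apply the 0-1 indicator matrix of the support of A to the
   all-ones vector. *)
theory Submission
  imports Defs
begin

text \<open>Schur's test. Weighted Cauchy-Schwarz in each row, with weights
  \<open>\<bar>M $ i $ j\<bar>\<close>, costs one factor \<open>r\<close>; summing over the rows and
  exchanging the sums then turns the remaining weights into column sums, which cost the factor
  \<open>c\<close>.\<close>

lemma onorm_matrix_le_schur:
  fixes M :: "real^'n^'m"
  assumes row: "\<And>i. (\<Sum>j\<in>UNIV. \<bar>M $ i $ j\<bar>) \<le> r"
    and col: "\<And>j. (\<Sum>i\<in>UNIV. \<bar>M $ i $ j\<bar>) \<le> c"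
  shows "onorm ((*v) M) \<le> sqrt (r * c)"
proof (rule onorm_le)
  fix x :: "real^'n"
  have r0: "0 \<le> r"
    by (rule order_trans[OF _ row]) (simp add: sum_nonneg)
  have entry: "((M *v x) $ i)\<^sup>2 \<le> r * (\<Sum>j\<in>UNIV. \<bar>M $ i $ j\<bar> * (x $ j)\<^sup>2)" for i
  proof -
    have "\<bar>(M *v x) $ i\<bar> \<le> (\<Sum>j\<in>UNIV. \<bar>M $ i $ j\<bar> * \<bar>x $ j\<bar>)"
      by (simp add: matrix_vector_mult_def sum_abs flip: abs_mult)
    \<comment> \<open>Half of each weight goes to either factor, so that Cauchy-Schwarz leaves a
      pure row sum and a sum that is still linear in \<open>\<bar>M $ i $ j\<bar>\<close>.\<close>
    also have "\<dots> = (\<Sum>j\<in>UNIV. sqrt \<bar>M $ i $ j\<bar> * (sqrt \<bar>M $ i $ j\<bar> * \<bar>x $ j\<bar>))"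
      by (simp flip: mult.assoc)
    finally have "((M *v x) $ i)\<^sup>2
        \<le> (\<Sum>j\<in>UNIV. sqrt \<bar>M $ i $ j\<bar> * (sqrt \<bar>M $ i $ j\<bar> * \<bar>x $ j\<bar>))\<^sup>2"
      using power_mono[of "\<bar>(M *v x) $ i\<bar>" _ 2] by simp
    also have "\<dots> \<le> (\<Sum>j\<in>UNIV. (sqrt \<bar>M $ i $ j\<bar>)\<^sup>2)
        * (\<Sum>j\<in>UNIV. (sqrt \<bar>M $ i $ j\<bar> * \<bar>x $ j\<bar>)\<^sup>2)"
      by (rule Cauchy_Schwarz_ineq_sum)
    also have "\<dots> = (\<Sum>j\<in>UNIV. \<bar>M $ i $ j\<bar>) * (\<Sum>j\<in>UNIV. \<bar>M $ i $ j\<bar> * (x $ j)\<^sup>2)"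
      by (simp add: power_mult_distrib)
    also have "\<dots> \<le> r * (\<Sum>j\<in>UNIV. \<bar>M $ i $ j\<bar> * (x $ j)\<^sup>2)"
      by (intro mult_right_mono row sum_nonneg) simp
    finally show ?thesis .
  qed
  have "(norm (M *v x))\<^sup>2 = (\<Sum>i\<in>UNIV. ((M *v x) $ i)\<^sup>2)"
    by (simp add: norm_vec_def L2_set_def sum_nonneg)
  also have "\<dots> \<le> (\<Sum>i\<in>UNIV. r * (\<Sum>j\<in>UNIV. \<bar>M $ i $ j\<bar> * (x $ j)\<^sup>2))"
    by (intro sum_mono entry)
  \<comment> \<open>With \<open>j\<close> outermost, \<open>(x $ j)\<^sup>2\<close> factors out and
    the inner sum is a column sum.\<close>
  also have "\<dots> = r * (\<Sum>j\<in>UNIV. (\<Sum>i\<in>UNIV. \<bar>M $ i $ j\<bar>) * (x $ j)\<^sup>2)"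
    unfolding sum_distrib_left[symmetric] sum_distrib_right by (subst sum.swap) (rule refl)
  also have "\<dots> \<le> r * (\<Sum>j\<in>UNIV. c * (x $ j)\<^sup>2)"
    by (intro mult_left_mono sum_mono mult_right_mono col r0) simp
  also have "\<dots> = r * c * (norm x)\<^sup>2"
    by (simp add: norm_vec_def L2_set_def sum_nonneg flip: sum_distrib_left)
  finally show "norm (M *v x) \<le> sqrt (r * c) * norm x"
    using real_sqrt_le_mono by (fastforce simp: real_sqrt_mult)
qed

text \<open>The all-ones vector, written \<open>1\<close>, is the test vector: the entries of
  \<open>M *v 1\<close> are the row sums of \<open>M\<close>.\<close>

lemma spectral_norm_ge_row_sum:
  fixes M :: "real^'n^'n"
  assumes row: "\<And>i. d \<le> (\<Sum>j\<in>UNIV. M $ i $ j)" and "0 \<le> d"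
  shows "d \<le> spectral_norm M"
proof -
  have "d * norm (1::real^'n) = norm (d *\<^sub>R (1::real^'n))"
    using \<open>0 \<le> d\<close> by simp
  \<comment> \<open>Since \<open>d\<close> is nonnegative, the lower bound on the row sums is also
    one on their absolute values, as the componentwise comparison demands.\<close>
  also have "\<dots> \<le> norm (M *v 1)"
    by (rule norm_le_componentwise_cart)
      (use row \<open>0 \<le> d\<close> in \<open>simp add: matrix_vector_mult_def order_trans[OF row abs_ge_self]\<close>)
  also have "\<dots> \<le> spectral_norm M * norm (1::real^'n)"
    unfolding spectral_norm_singular_value(3)
    by (rule onorm) (simp add: matrix_vector_mul_bounded_linear)
  \<comment> \<open>The all-ones vector is nonzero, so its norm cancels.\<close>
  finally show ?thesis
    by (simp add: vec_eq_iff)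
qed

theorem proposition3:
  fixes A :: "real^'n^'n" and deg_min deg_max :: nat
  assumes row_max: "\<And>i. card {j. A $ i $ j \<noteq> 0} \<le> deg_max"
    and col_max: "\<And>j. card {i. A $ i $ j \<noteq> 0} \<le> deg_max"
    and row_min: "\<And>i. deg_min \<le> card {j. A $ i $ j \<noteq> 0}"
    and col_min: "\<And>j. deg_min \<le> card {i. A $ i $ j \<noteq> 0}"
  shows "real deg_min \<le> mu A \<and> mu A \<le> real deg_max"
proof
  \<comment> \<open>The 0-1 pattern of \<open>A\<close> is admissible for \<open>mu A\<close>, and
    its row sums count the nonzero entries of the rows of \<open>A\<close>.\<close>
  define N :: "real^'n^'n" where "N = (\<chi> i j. if A $ i $ j \<noteq> 0 then 1 else 0)"
  have "(\<Sum>j\<in>UNIV. N $ i $ j) = real (card {j. A $ i $ j \<noteq> 0})" for i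
    by (simp add: N_def sum.If_cases)
  then have "real deg_min \<le> spectral_norm N"
    by (intro spectral_norm_ge_row_sum) (simp_all add: row_min)
  also have "\<dots> \<le> mu A"
    by (rule mu_attained(2))
      (auto simp: N_def Omega_def mat_support_def entry_norm_le_iff split: if_splits)
  finally show "real deg_min \<le> mu A" .
next
  obtain N where N: "N \<in> Omega A" "entry_norm N \<le> 1" and mu: "mu A = spectral_norm N"
    using mu_attained(1) by blast
  \<comment> \<open>Support and size constraint merge into one bound, whose sum along a row or
    column is the count of nonzero entries of \<open>A\<close> there.\<close>
  have entry: "\<bar>N $ i $ j\<bar> \<le> of_bool (A $ i $ j \<noteq> 0)" for i j
    using N by (auto simp: Omega_def mat_support_def entry_norm_le_iff)
  have "(\<Sum>j\<in>UNIV. \<bar>N $ i $ j\<bar>) \<le> real deg_max" for i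
  proof -
    have "(\<Sum>j\<in>UNIV. \<bar>N $ i $ j\<bar>) \<le> (\<Sum>j\<in>UNIV. of_bool (A $ i $ j \<noteq> 0))"
      by (intro sum_mono entry)
    also have "\<dots> \<le> real deg_max"
      using row_max[of i] by simp
    finally show ?thesis .
  qed
  moreover have "(\<Sum>i\<in>UNIV. \<bar>N $ i $ j\<bar>) \<le> real deg_max" for j
  proof -
    have "(\<Sum>i\<in>UNIV. \<bar>N $ i $ j\<bar>) \<le> (\<Sum>i\<in>UNIV. of_bool (A $ i $ j \<noteq> 0))"
      by (intro sum_mono entry)
    also have "\<dots> \<le> real deg_max"
      using col_max[of j] by simp
    finally show ?thesis .
  qed
  \<comment> \<open>Rows and columns share the bound \<open>deg_max\<close>, so the geometric mean
    in Schur's test is \<open>deg_max\<close> itself.\<close>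
  ultimately have "onorm ((*v) N) \<le> sqrt (real deg_max * real deg_max)"
    by (rule onorm_matrix_le_schur)
  then show "mu A \<le> real deg_max"
    by (simp add: mu spectral_norm_singular_value(3))
qed

end
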